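(* Let $G$ be a subcubic graph with $c=c(G)$ components, and write $\nu(G)$ for its matching number and $n_i$ for its number of vertices of degree $i$. Then all five of the following inequalities hold: \begin{align*} \nu(G)&\geq \frac{n_2}{2}+\frac{n_1}{2}-\frac{c}{2},\\ \nu(G)&\geq \frac{n_2}{3}+\frac{2n_1}{3}-c,\\ \nu(G)&\geq \frac{n_3}{4}+\frac{n_2}{2}+\frac{n_1}{4}-\frac{c}{2},\\ \nu(G)&\geq \frac{7n_3}{16}+\frac{3n_2}{8}+\frac{3n_1}{16}-\frac{c}{8},\\ \nu(G)&\geq \frac{4n_3}{9}+\frac{n_2}{3}+\frac{2n_1}{9}-\frac{c}{9}. \end{align*}
   Context: Graphs are finite and simple. A graph is subcubic if its maximum degree is at most three. $\nu(G)$ denotes the maximum size (number of edges) of a matching in $G$, $n_i$ denotes the number of vertices of degree $i$ in $G$, and $c(G)$ denotes the number of connected components of $G$. *)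

theory Defs
  imports Complex_Main
begin

text \<open>
  A finite simple graph is given by a finite vertex set \<open>V\<close> and a set \<open>E\<close> of
  two-element subsets of \<open>V\<close>. The graph with no vertices is allowed; it has no components.
\<close>

definition simple_graph :: "'a set \<Rightarrow> 'a set set \<Rightarrow> bool" where
  "simple_graph V E \<longleftrightarrow> finite V \<and> (\<forall>e\<in>E. e \<subseteq> V \<and> card e = 2)"

definition degree :: "'a set set \<Rightarrow> 'a \<Rightarrow> nat" where
  "degree E v = card {e \<in> E. v \<in> e}"

definition subcubic :: "'a set \<Rightarrow> 'a set set \<Rightarrow> bool" where
  "subcubic V E \<longleftrightarrow> (\<forall>v\<in>V. degree E v \<le> 3)"

definition num_degree :: "'a set \<Rightarrow> 'a set set \<Rightarrow> nat \<Rightarrow> nat" where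
  "num_degree V E i = card {v \<in> V. degree E v = i}"

definition matching :: "'a set set \<Rightarrow> 'a set set \<Rightarrow> bool" where
  "matching E M \<longleftrightarrow> M \<subseteq> E \<and> pairwise disjnt M"

text \<open>For a finite graph the set below is finite, and it contains \<open>0\<close>.\<close>

definition matching_number :: "'a set set \<Rightarrow> nat" where
  "matching_number E = Max {card M | M. matching E M}"

definition adj_rel :: "'a set set \<Rightarrow> 'a rel" where
  "adj_rel E = {(u, v). {u, v} \<in> E}"

text \<open>
  The reflexive transitive closure relates every element of the type to itself, so it is
  restricted to \<open>V\<close>; its classes are the vertex sets of the connected components,
  isolated vertices included.
\<close>

definition connected_rel :: "'a set \<Rightarrow> 'a set set \<Rightarrow> 'a rel" where
  "connected_rel V E = (adj_rel E)\<^sup>* \<inter> V \<times> V"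

definition num_components :: "'a set \<Rightarrow> 'a set set \<Rightarrow> nat" where
  "num_components V E = card (V // connected_rel V E)"

end

theory Submission
  imports Defs
begin

text \<open>
  Each of the five inequalities is an upper bound on the deficiency, the number of vertices minus
  twice the matching number, by a sum of weights that depend only on the vertex degrees plus a
  multiple of the number of components \<open>c\<close>. By the Tutte--Berge formula (\<open>tutte_berge\<close>) there is a vertex set \<open>S\<close> such that
  the deficiency is at most the number of odd components of the graph without \<open>S\<close>, minus \<open>card S\<close>.
  It remains to compare this difference with the weights, by discharging.

  Write \<open>d(C)\<close> for the number of edges between \<open>S\<close> and a component \<open>C\<close> of the graph without \<open>S\<close>. Three
  global facts are used. The degrees in \<open>S\<close> sum up to \<open>\<Sum>d(C)\<close> plus twice the number of edges inside
  \<open>S\<close>. The graph obtained by contracting every \<open>C\<close> has at least as many edges as vertices, up to \<open>c\<close>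
  (\<open>contracted_components_le\<close>). At most \<open>c\<close> of the \<open>C\<close> have \<open>d(C) = 0\<close>. Taking these facts with
  suitable multipliers \<open>\<beta>\<close>, \<open>\<alpha>\<close> and \<open>\<gamma>\<close> reduces each inequality to a condition on single vertices of
  \<open>S\<close> and on single components (\<open>deficiency_le_weight\<close>).

  With weight \<open>1\<close> in degree \<open>0\<close>, the choices are

    weights in degrees 1, 2, 3:  \<open>0, 0, 1\<close>          with  \<open>\<alpha> = 1/2, \<beta> = 1/2, \<gamma> = 0\<close>;

    weights in degrees 1, 2, 3:  \<open>-1/3, 1/3, 1\<close>     with  \<open>\<alpha> = 1, \<beta> = 1/3, \<gamma> = 0\<close>;

    weights in degrees 1, 2, 3:  \<open>1/2, 0, 1/2\<close>      with  \<open>\<alpha> = 0, \<beta> = 1/2, \<gamma> = 1\<close>;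

    weights in degrees 1, 2, 3:  \<open>5/8, 1/4, 1/8\<close>    with  \<open>\<alpha> = 0, \<beta> = 3/8, \<gamma> = 1/4\<close>;

    weights in degrees 1, 2, 3:  \<open>5/9, 1/3, 1/9\<close>    with  \<open>\<alpha> = 1/9, \<beta> = 1/3, \<gamma> = 0\<close>.

  The condition on components follows from the bounds on the number of edges that connectedness and
  simplicity impose on \<open>C\<close>, and from parity (\<open>component_bound_1\<close> to \<open>component_bound_5\<close>).
\<close>

section \<open>Finite simple graphs\<close>

lemma simple_graph_finite:
  assumes "simple_graph V E"
  shows "finite V" "finite E"
proof -
  show "finite V" using assms by (simp add: simple_graph_def)
  moreover have "E \<subseteq> Pow V" using assms by (auto simp: simple_graph_def)
  ultimately show "finite E" by (meson finite_Pow_iff finite_subset)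
qed

lemma simple_graph_edge:
  assumes "simple_graph V E" "e \<in> E"
  shows "e \<subseteq> V" "card e = 2" "finite e" "\<exists>x y. e = {x, y} \<and> x \<noteq> y"
  using assms by (auto simp: simple_graph_def card_2_iff)

lemma simple_graph_subset:
  assumes "simple_graph V E" "F \<subseteq> E" "W \<subseteq> V" "\<And>e. e \<in> F \<Longrightarrow> e \<subseteq> W"
  shows "simple_graph W F"
  using assms by (auto simp: simple_graph_def intro: finite_subset)

section \<open>Maximum matchings\<close>

text \<open>A matching of the largest possible size. A vertex \<open>v\<close> is missed by it when \<open>v \<notin> \<Union>M\<close>.\<close>

definition maximum_matching :: "'a set set \<Rightarrow> 'a set set \<Rightarrow> bool" where
  "maximum_matching E M \<longleftrightarrow> matching E M \<and> card M = matching_number E"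

lemma matching_finite: "finite E \<Longrightarrow> matching E M \<Longrightarrow> finite M"
  by (auto simp: matching_def intro: finite_subset)

lemma matching_sizes_finite:
  assumes "finite E"
  shows "finite {card M | M. matching E M}"
proof -
  have "{card M | M. matching E M} \<subseteq> card ` Pow E"
    by (auto simp: matching_def)
  then show ?thesis using assms by (meson finite_Pow_iff finite_imageI finite_subset)
qed

lemma card_matching_le:
  assumes "finite E" "matching E M"
  shows "card M \<le> matching_number E"
  unfolding matching_number_def
  by (rule Max_ge) (use assms matching_sizes_finite in auto)

lemma maximum_matching_exists:
  assumes "finite E"
  obtains M where "maximum_matching E M"
proof -
  have "matching E {}" by (simp add: matching_def)
  then have "{card M | M. matching E M} \<noteq> {}" by blast
  then have "matching_number E \<in> {card M | M. matching E M}"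
    unfolding matching_number_def using matching_sizes_finite[OF assms] by (rule Max_in[rotated])
  then show ?thesis using that by (auto simp: maximum_matching_def)
qed

lemma matching_edges_meet:
  assumes "matching E M" "e \<in> M" "f \<in> M" "x \<in> e" "x \<in> f"
  shows "e = f"
  using assms by (auto simp: matching_def pairwise_def disjnt_def)

lemma matching_mono: "matching E M \<Longrightarrow> E \<subseteq> F \<Longrightarrow> matching F M"
  by (auto simp: matching_def)

lemma matching_subset: "matching E M \<Longrightarrow> N \<subseteq> M \<Longrightarrow> matching E N"
  by (auto simp: matching_def intro: pairwise_subset)

lemma matching_insert:
  assumes "matching E M" "e \<in> E" "e \<inter> \<Union>M = {}"
  shows "matching E (insert e M)"
  using assms by (auto simp: matching_def pairwise_insert disjnt_def)

lemma card_matching_vertices: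
  assumes "simple_graph V E" "matching E M"
  shows "card (\<Union>M) = 2 * card M"
proof -
  have "card (\<Union>M) = (\<Sum>e\<in>M. card e)"
    using assms by (intro card_Union_disjoint) (auto simp: matching_def simple_graph_edge(3) dest: subsetD)
  also have "\<dots> = (\<Sum>e\<in>M. 2)"
    using assms by (intro sum.cong) (auto simp: matching_def simple_graph_edge(2) dest: subsetD)
  finally show ?thesis by simp
qed

lemma matching_vertices_subset:
  assumes "simple_graph V E" "matching E M"
  shows "\<Union>M \<subseteq> V"
  using assms simple_graph_edge(1) by (fastforce simp: matching_def)

text \<open>One exchange step: a maximum matching \<open>N\<close> that covers two vertices missed by \<open>M\<close>
  can be brought closer to \<open>M\<close> without covering a given vertex \<open>v\<close> that it misses.\<close>

lemma gallai_swap: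
  assumes G: "simple_graph V E"
    and M: "maximum_matching E M" and N: "maximum_matching E N"
    and uw: "u \<noteq> w" "u \<notin> \<Union>M" "w \<notin> \<Union>M" "u \<in> \<Union>N" "w \<in> \<Union>N"
    and v: "v \<notin> \<Union>N"
  obtains N' where "maximum_matching E N'" "v \<notin> \<Union>N'" "card (M \<inter> N) < card (M \<inter> N')"
proof -
  have fin: "finite V" "finite E" using simple_graph_finite[OF G] by auto
  have mM: "matching E M" and mN: "matching E N" and cMN: "card M = card N"
    using M N by (auto simp: maximum_matching_def)
  have finM: "finite (\<Union>M)" and finN: "finite (\<Union>N)"
    using matching_vertices_subset[OF G mM] matching_vertices_subset[OF G mN] fin(1)
    by (blast intro: finite_subset)+
  \<comment> \<open>Both matchings cover equally many vertices, and \<open>N\<close> covers \<open>u\<close> and \<open>w\<close> which \<open>M\<close> misses;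
    hence \<open>M\<close> covers at least two vertices missed by \<open>N\<close>, one of them different from \<open>v\<close>.\<close>
  have "card (\<Union>M) = card (\<Union>N)"
    using card_matching_vertices[OF G] mM mN cMN by simp
  then have "card (\<Union>N - \<Union>M) \<le> card (\<Union>M - \<Union>N)"
    using finM finN by (intro card_le_sym_Diff) auto
  moreover have "card {u, w} \<le> card (\<Union>N - \<Union>M)"
    using uw finN by (intro card_mono) auto
  ultimately have "2 \<le> card (\<Union>M - \<Union>N)" using uw(1) by simp
  then have "\<not> \<Union>M - \<Union>N \<subseteq> {v}"
    using card_mono[of "{v}" "\<Union>M - \<Union>N"] by auto
  then obtain x where x: "x \<in> \<Union>M" "x \<notin> \<Union>N" "x \<noteq> v" by blast
  then obtain e where e: "e \<in> M" "x \<in> e" by blast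
  have eE: "e \<in> E" using mM e by (auto simp: matching_def)
  \<comment> \<open>The other end of \<open>e\<close> is covered by an edge \<open>f\<close> of \<open>N\<close>, since otherwise \<open>e\<close> would enlarge \<open>N\<close>;
    replacing \<open>f\<close> by \<open>e\<close> is the exchange.\<close>
  obtain y where y: "e = {x, y}" "x \<noteq> y"
    using simple_graph_edge(4)[OF G eE] e by (metis doubleton_eq_iff insertE singletonD)
  have eN: "e \<notin> N" using x e by blast
  have finN': "finite N" using matching_finite fin mN by blast
  have "y \<in> \<Union>N"
  proof (rule ccontr)
    assume "y \<notin> \<Union>N"
    then have "matching E (insert e N)"
      using mN eE x y by (intro matching_insert) auto
    then have "card (insert e N) \<le> matching_number E" using card_matching_le fin by blast
    then show False using eN finN' N by (simp add: maximum_matching_def)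
  qed
  then obtain f where f: "f \<in> N" "y \<in> f" by blast
  have fM: "f \<notin> M"
    using matching_edges_meet[OF mM e(1), of f y] f y eN by auto
  define N' where "N' = insert e (N - {f})"
  have yN: "y \<notin> \<Union>(N - {f})"
    using matching_edges_meet[OF mN f(1), of _ y] f by blast
  have "matching E N'" unfolding N'_def
    using matching_subset[OF mN] eE x y yN by (intro matching_insert) auto
  moreover have "card N' = card N"
    using card.remove[OF finN' f(1)] eN finN' unfolding N'_def by simp
  ultimately have "maximum_matching E N'" using N by (simp add: maximum_matching_def)
  moreover have "v \<notin> \<Union>N'"
    using v x y f unfolding N'_def by auto
  moreover have "card (M \<inter> N) < card (M \<inter> N')"
  proof (rule psubset_card_mono)
    show "finite (M \<inter> N')" using finN' by (simp add: N'_def)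
    show "M \<inter> N \<subset> M \<inter> N'" using fM e eN unfolding N'_def by auto
  qed
  ultimately show ?thesis using that by blast
qed

text \<open>If no maximum matching misses both \<open>u\<close> and \<open>v\<close>, and none misses both \<open>v\<close> and \<open>w\<close>, while some
  maximum matching misses \<open>v\<close>, then none misses both \<open>u\<close> and \<open>w\<close>, if these are distinct. The
  lemma is the contrapositive. Its witness is a maximum matching missing \<open>v\<close> that shares as many
  edges as possible with \<open>M\<close>.\<close>

lemma gallai_transitive:
  assumes G: "simple_graph V E"
    and M: "maximum_matching E M" and uw: "u \<noteq> w" "u \<notin> \<Union>M" "w \<notin> \<Union>M"
    and N: "maximum_matching E N" and v: "v \<notin> \<Union>N"
  obtains K where "maximum_matching E K" "v \<notin> \<Union>K" "u \<notin> \<Union>K \<or> w \<notin> \<Union>K"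
proof -
  let ?P = "\<lambda>K. maximum_matching E K \<and> v \<notin> \<Union>K"
  have finM: "finite M"
    using M simple_graph_finite(2)[OF G] matching_finite by (auto simp: maximum_matching_def)
  have "\<forall>K. ?P K \<longrightarrow> card (M \<inter> K) \<le> card M"
    using finM by (auto intro: card_mono)
  then have "\<exists>K. ?P K \<and> (\<forall>L. ?P L \<longrightarrow> card (M \<inter> L) \<le> card (M \<inter> K))"
    using N v by (intro ex_has_greatest_nat[of ?P N _ "card M + 1"]) (auto simp: less_Suc_eq_le)
  then obtain K where K: "?P K" "\<And>L. ?P L \<Longrightarrow> card (M \<inter> L) \<le> card (M \<inter> K)" by blast
  have "u \<notin> \<Union>K \<or> w \<notin> \<Union>K"
  proof (rule ccontr)
    assume "\<not> ?thesis"
    then obtain L where "?P L" "card (M \<inter> K) < card (M \<inter> L)"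
      using gallai_swap[OF G M _ uw] K(1) by metis
    then show False using K(2) by fastforce
  qed
  then show ?thesis using that K by blast
qed

section \<open>Connected components\<close>

lemma connected_rel_equiv: "equiv V (connected_rel V E)"
proof (rule equivI)
  show "refl_on V (connected_rel V E)" by (auto simp: connected_rel_def refl_on_def)
  have "sym (adj_rel E)" by (auto simp: adj_rel_def sym_def insert_commute)
  then show "sym (connected_rel V E)"
    by (auto simp: connected_rel_def intro!: sym_Int sym_rtrancl) (auto simp: sym_def)
  show "trans (connected_rel V E)" by (auto simp: connected_rel_def trans_def)
  show "connected_rel V E \<subseteq> V \<times> V" by (auto simp: connected_rel_def)
qed

lemma adj_relD:
  assumes "simple_graph V E" "(x, y) \<in> adj_rel E"
  shows "x \<in> V" "y \<in> V" "x \<noteq> y" "{x, y} \<in> E"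
  using assms by (auto simp: adj_rel_def simple_graph_def)

lemma connected_rel_step:
  assumes "simple_graph V E" "(x, y) \<in> connected_rel V E" "{y, z} \<in> E"
  shows "(x, z) \<in> connected_rel V E"
  using assms simple_graph_edge(1)[OF assms(1,3)]
  by (auto simp: connected_rel_def adj_rel_def intro: rtrancl_into_rtrancl)

lemma component_edge_subset:
  assumes "simple_graph V E" "C \<in> V // connected_rel V E" "e \<in> E" "e \<inter> C \<noteq> {}"
  shows "e \<subseteq> C"
proof -
  obtain x where x: "x \<in> V" "C = connected_rel V E `` {x}" using assms(2) by (auto elim: quotientE)
  obtain y where y: "y \<in> e" "y \<in> C" using assms(4) by blast
  then have "\<And>z. z \<in> e \<Longrightarrow> z \<noteq> y \<Longrightarrow> e = {y, z}"
    using simple_graph_edge(4)[OF assms(1,3)] by blast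
  then show ?thesis using connected_rel_step[OF assms(1), of x y] x y assms(3) by blast
qed

lemma connected_rel_finite_quotient: "finite V \<Longrightarrow> finite (V // connected_rel V E)"
  by (rule finite_quotient) (auto simp: connected_rel_def)

text \<open>A component of a subgraph that no further edge of the whole graph leaves is a component of the
  whole graph.\<close>

lemma component_of_supergraph:
  assumes "W \<subseteq> V" "F \<subseteq> E" "C \<in> W // connected_rel W F"
    and closed: "\<And>e. e \<in> E \<Longrightarrow> e \<inter> C \<noteq> {} \<Longrightarrow> e \<subseteq> C"
  shows "C \<in> V // connected_rel V E"
proof -
  obtain x where x: "x \<in> W" "C = connected_rel W F `` {x}" using assms(3) by (auto elim: quotientE)
  have "adj_rel F \<subseteq> adj_rel E" using assms(2) by (auto simp: adj_rel_def)
  then have "(adj_rel F)\<^sup>* \<subseteq> (adj_rel E)\<^sup>*" by (rule rtrancl_mono)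
  then have "C \<subseteq> connected_rel V E `` {x}"
    unfolding x(2) connected_rel_def using assms(1) by blast
  moreover have "y \<in> C" if "(x, y) \<in> (adj_rel E)\<^sup>*" for y
    using that
  proof induction
    case base
    show ?case using x by (simp add: connected_rel_def)
  next
    case (step y z)
    then show ?case using closed[of "{y, z}"] by (auto simp: adj_rel_def)
  qed
  ultimately have "C = connected_rel V E `` {x}" by (auto simp: connected_rel_def)
  then show ?thesis using x(1) assms(1) by (auto intro: quotientI)
qed

lemma component_connected:
  assumes "simple_graph V E" "C \<in> V // connected_rel V E"
  shows "num_components C {e \<in> E. e \<subseteq> C} = 1"
proof -
  let ?F = "{e \<in> E. e \<subseteq> C}"
  obtain x where x: "x \<in> V" "C = connected_rel V E `` {x}" using assms(2) by (auto elim: quotientE)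
  have xC: "x \<in> C" using x by (simp add: connected_rel_def)
  have "y \<in> C \<and> (x, y) \<in> (adj_rel ?F)\<^sup>*" if "(x, y) \<in> (adj_rel E)\<^sup>*" for y
    using that
  proof induction
    case (step y z)
    then have "{y, z} \<subseteq> C"
      using component_edge_subset[OF assms, of "{y, z}"] by (auto simp: adj_rel_def)
    with step show ?case by (auto simp: adj_rel_def intro: rtrancl_into_rtrancl)
  qed (use xC in auto)
  then have "connected_rel C ?F `` {x} = C"
    using x xC by (auto simp: connected_rel_def)
  then have "connected_rel C ?F `` {y} = C" if "y \<in> C" for y
    using equiv_class_eq[OF connected_rel_equiv, of x y C ?F] that by auto
  then have "C // connected_rel C ?F = {C}" unfolding quotient_def using xC by blast
  then show ?thesis by (simp add: num_components_def)
qed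

lemma connected_rel_insert_edge:
  assumes "(a, b) \<in> connected_rel V (insert {u, v} E)" "u \<in> V" "v \<in> V" "simple_graph V E"
  shows "(a, b) \<in> connected_rel V E
    \<or> (u, a) \<in> connected_rel V E \<and> (v, b) \<in> connected_rel V E
    \<or> (v, a) \<in> connected_rel V E \<and> (u, b) \<in> connected_rel V E"
proof -
  let ?R = "connected_rel V E"
  have sym: "\<And>x y. (x, y) \<in> ?R \<Longrightarrow> (y, x) \<in> ?R"
    and trans: "\<And>x y z. (x, y) \<in> ?R \<Longrightarrow> (y, z) \<in> ?R \<Longrightarrow> (x, z) \<in> ?R"
    using connected_rel_equiv[of V E] by (meson equivE symE transE)+
  have aV: "a \<in> V" and ab: "(a, b) \<in> (adj_rel (insert {u, v} E))\<^sup>*"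
    using assms(1) by (auto simp: connected_rel_def)
  have aa: "(a, a) \<in> ?R" using aV by (simp add: connected_rel_def)
  have uv: "(u, u) \<in> ?R" "(v, v) \<in> ?R" using assms(2,3) by (auto simp: connected_rel_def)
  from ab show ?thesis
  proof induction
    case (step y z)
    from step(2) consider "{y, z} \<in> E" | "y = u" "z = v" | "y = v" "z = u"
      by (auto simp: adj_rel_def doubleton_eq_iff)
    then show ?case
    proof cases
      case 1
      then show ?thesis using step(3) connected_rel_step[OF assms(4)] by blast
    next
      case 2
      then show ?thesis using step(3) uv sym trans by blast
    next
      case 3
      then show ?thesis using step(3) uv sym trans by blast
    qed
  qed (use aa in auto)
qed

text \<open>An edge merges at most two components: apart from the component of its end \<open>u\<close>, distinct
  components stay distinct.\<close>

lemma num_components_insert_edge: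
  assumes G: "simple_graph V (insert e E)"
  shows "num_components V E \<le> num_components V (insert e E) + 1"
proof -
  obtain u v where e: "e = {u, v}" using simple_graph_edge(4)[OF G] by blast
  have uv: "u \<in> V" "v \<in> V" using simple_graph_edge(1)[OF G] e by auto
  have finV: "finite V" using simple_graph_finite G by blast
  have GE: "simple_graph V E" using G by (simp add: simple_graph_def)
  let ?R = "connected_rel V E" and ?R' = "connected_rel V (insert e E)"
  have R: "equiv V ?R" and R': "equiv V ?R'" by (rule connected_rel_equiv)+
  have "(adj_rel E)\<^sup>* \<subseteq> (adj_rel (insert e E))\<^sup>*"
    by (rule rtrancl_mono) (auto simp: adj_rel_def)
  then have sub: "?R \<subseteq> ?R'" unfolding connected_rel_def by blast
  have img: "?R' `` (?R `` {x}) = ?R' `` {x}" if "x \<in> V" for x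
  proof -
    have "(x, x) \<in> ?R" using that by (simp add: connected_rel_def)
    moreover have "(x, z) \<in> ?R'" if "(x, y) \<in> ?R" "(y, z) \<in> ?R'" for y z
      using that sub R' by (blast elim: equivE dest: transD)
    ultimately show ?thesis by blast
  qed
  have "inj_on (\<lambda>C. ?R' `` C) (V // ?R - {?R `` {u}})"
  proof (rule inj_onI)
    fix C D assume C: "C \<in> V // ?R - {?R `` {u}}" and D: "D \<in> V // ?R - {?R `` {u}}"
      and eq: "?R' `` C = ?R' `` D"
    obtain x y where x: "x \<in> V" "C = ?R `` {x}" and y: "y \<in> V" "D = ?R `` {y}"
      using C D by (auto elim!: quotientE)
    have "?R' `` {x} = ?R' `` {y}" using eq img x y by simp
    then have "(x, y) \<in> ?R'" using y(1) by (rule eq_equiv_class[OF _ R'])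
    then have "(x, y) \<in> ?R \<or> (u, x) \<in> ?R \<or> (u, y) \<in> ?R"
      using connected_rel_insert_edge[of x y V u v E] uv GE e by auto
    moreover have "(u, x) \<notin> ?R" "(u, y) \<notin> ?R"
      using C D x(2) y(2) equiv_class_eq[OF R, of u] by auto
    ultimately show "C = D" using x(2) y(2) equiv_class_eq[OF R] by simp
  qed
  moreover have "(\<lambda>C. ?R' `` C) ` (V // ?R - {?R `` {u}}) \<subseteq> V // ?R'"
    using img by (auto elim!: quotientE intro: quotientI)
  ultimately have "card (V // ?R - {?R `` {u}}) \<le> card (V // ?R')"
    by (rule card_inj_on_le) (rule connected_rel_finite_quotient[OF finV])
  moreover have "?R `` {u} \<in> V // ?R" using uv by (rule_tac quotientI)
  ultimately show ?thesis
    using connected_rel_finite_quotient[OF finV, of E]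
    by (simp add: num_components_def card_Diff_singleton)
qed

lemma num_components_add_edges:
  assumes "finite F" "simple_graph V (E \<union> F)"
  shows "num_components V E \<le> num_components V (E \<union> F) + card F"
  using assms
proof (induction F rule: finite_induct)
  case (insert e F)
  have "simple_graph V (E \<union> F)" using insert.prems by (auto simp: simple_graph_def)
  with insert num_components_insert_edge[of V e "E \<union> F"] show ?case by simp
qed simp

lemma num_components_no_edges:
  "num_components V {} = card V"
proof -
  have "connected_rel V {} = Id_on V" by (auto simp: connected_rel_def adj_rel_def)
  then have "V // connected_rel V {} = (\<lambda>x. {x}) ` V"
    by (auto simp: quotient_def)
  then show ?thesis by (simp add: num_components_def card_image)
qed

text \<open>A connected graph on \<open>n\<close> vertices has at least \<open>n - 1\<close> edges.\<close>

lemma component_card_le_edges: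
  assumes "simple_graph V E" "C \<in> V // connected_rel V E"
  shows "card C \<le> card {e \<in> E. e \<subseteq> C} + 1"
proof -
  let ?F = "{e \<in> E. e \<subseteq> C}"
  have "C \<subseteq> V" using in_quotient_imp_subset[OF connected_rel_equiv assms(2)] .
  then have "simple_graph C ?F" by (intro simple_graph_subset[OF assms(1)]) auto
  then have "num_components C {} \<le> num_components C ({} \<union> ?F) + card ?F"
    using simple_graph_finite by (intro num_components_add_edges) auto
  then show ?thesis
    using component_connected[OF assms] by (simp add: num_components_no_edges)
qed

section \<open>The Tutte--Berge formula\<close>

lemma card_missed_vertices:
  assumes "simple_graph V E" "maximum_matching E M"
  shows "card (V - \<Union>M) + 2 * matching_number E = card V"
proof -
  have M: "matching E M" "card M = matching_number E"
    using assms(2) by (auto simp: maximum_matching_def)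
  have sub: "\<Union>M \<subseteq> V" using matching_vertices_subset[OF assms(1) M(1)] .
  have fin: "finite V" using simple_graph_finite(1)[OF assms(1)] .
  have "card (V - \<Union>M) = card V - card (\<Union>M)"
    using sub fin finite_subset by (intro card_Diff_subset) auto
  moreover have "card (\<Union>M) \<le> card V" using sub fin by (rule card_mono[rotated])
  ultimately show ?thesis using card_matching_vertices[OF assms(1) M(1)] M(2) by simp
qed

lemma maximum_matching_meets_edge:
  assumes "finite E" "maximum_matching E M" "e \<in> E" "e \<noteq> {}"
  shows "e \<inter> \<Union>M \<noteq> {}"
proof
  assume *: "e \<inter> \<Union>M = {}"
  have M: "matching E M" using assms by (simp add: maximum_matching_def)
  have "e \<notin> M" using * assms(4) by blast
  then have "card (insert e M) = card M + 1" using matching_finite[OF assms(1) M] by simp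
  moreover have "card (insert e M) \<le> matching_number E"
    using matching_insert[OF M assms(3) *] card_matching_le assms(1) by blast
  ultimately show False using assms(2) by (simp add: maximum_matching_def)
qed

text \<open>Gallai's lemma. A vertex is called inessential if some maximum matching misses it. When all
  vertices are inessential, a maximum matching misses at most one vertex of each component. The proof
  goes along a path from \<open>u\<close> to \<open>w\<close>: a maximum matching never misses two adjacent vertices, and
  \<open>gallai_transitive\<close> extends this to vertices further apart.\<close>

lemma gallai_missed_distinct_components:
  assumes G: "simple_graph V E"
    and inessential: "\<And>v. v \<in> V \<Longrightarrow> \<exists>M. maximum_matching E M \<and> v \<notin> \<Union>M"
    and M: "maximum_matching E M" and "u \<notin> \<Union>M" "w \<notin> \<Union>M"
    and conn: "(u, w) \<in> (adj_rel E)\<^sup>*"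
  shows "u = w"
proof -
  note finE = simple_graph_finite(2)[OF G]
  from conn have "\<forall>M. maximum_matching E M \<and> u \<notin> \<Union>M \<and> w \<notin> \<Union>M \<longrightarrow> u = w"
  proof induction
    case (step y z)
    have y: "y \<in> V" "y \<noteq> z" and yz: "{y, z} \<in> E" using adj_relD[OF G step(2)] by auto
    have adj: False if "maximum_matching E K" "y \<notin> \<Union>K" "z \<notin> \<Union>K" for K
      using maximum_matching_meets_edge[OF finE that(1) yz] that by auto
    show ?case
    proof (intro allI impI)
      fix M assume M: "maximum_matching E M \<and> u \<notin> \<Union>M \<and> z \<notin> \<Union>M"
      show "u = z"
      proof (rule ccontr)
        assume uz: "u \<noteq> z"
        obtain N where N: "maximum_matching E N" "y \<notin> \<Union>N" using inessential y by blast
        obtain K where K: "maximum_matching E K" "y \<notin> \<Union>K" "u \<notin> \<Union>K \<or> z \<notin> \<Union>K"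
          using gallai_transitive[OF G _ uz _ _ N] M by blast
        then have "u = y" using step(3) adj by blast
        then show False using adj M by blast
      qed
    qed
  qed simp
  then show ?thesis using assms by blast
qed

lemma odd_component_of_missed_vertex:
  assumes G: "simple_graph V E" and M: "matching E M"
    and C: "C \<in> V // connected_rel V E" and x: "x \<in> C" "x \<notin> \<Union>M"
    and only: "\<And>y. y \<in> C \<Longrightarrow> y \<notin> \<Union>M \<Longrightarrow> y = x"
  shows "odd (card C)"
proof -
  let ?M = "{e \<in> M. e \<subseteq> C}"
  have mM: "matching E ?M" using matching_subset[OF M] by auto
  have "e \<subseteq> C" if "e \<in> M" "y \<in> e" "y \<in> C" for e y
    using component_edge_subset[OF G C, of e] that M by (auto simp: matching_def)
  then have "y \<in> \<Union>?M" if "y \<in> C" "y \<noteq> x" for y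
    using only[of y] that by blast
  then have C_eq: "C = insert x (\<Union>?M)" using x(1) by blast
  have "finite (\<Union>?M)"
    using matching_vertices_subset[OF G mM] simple_graph_finite(1)[OF G] by (rule finite_subset)
  moreover have "x \<notin> \<Union>?M" using x(2) by blast
  ultimately have "card (insert x (\<Union>?M)) = Suc (card (\<Union>?M))" by (rule card_insert_disjoint)
  then have "card C = Suc (card (\<Union>?M))" by (subst C_eq)
  then show ?thesis using card_matching_vertices[OF G mM] by simp
qed

text \<open>The nontrivial half of the Tutte--Berge formula: some \<open>S\<close> attains the deficiency, that is,
  \<open>card V - 2 * matching_number E\<close> is at most the number of odd components of the graph
  without \<open>S\<close>, minus \<open>card S\<close>. A vertex that every maximum matching covers is put into \<open>S\<close> and
  deleted, which lowers the matching number. If there is no such vertex, \<open>S = {}\<close> works by Gallai's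
  lemma.\<close>

theorem tutte_berge:
  assumes "simple_graph V E"
  shows "\<exists>S\<subseteq>V. card V + card S \<le> 2 * matching_number E
    + card {C \<in> (V - S) // connected_rel (V - S) {e \<in> E. e \<inter> S = {}}. odd (card C)}"
  using assms
proof (induction "card V" arbitrary: V E rule: less_induct)
  case less
  note G = \<open>simple_graph V E\<close>
  have fin: "finite V" "finite E" using simple_graph_finite[OF G] by auto
  show ?case
  proof (cases "\<exists>v\<in>V. \<forall>M. maximum_matching E M \<longrightarrow> v \<in> \<Union>M")
    case True
    then obtain v where v: "v \<in> V" "\<And>M. maximum_matching E M \<Longrightarrow> v \<in> \<Union>M" by blast
    let ?V = "V - {v}" and ?E = "{e \<in> E. v \<notin> e}"
    have G': "simple_graph ?V ?E" using G by (auto simp: simple_graph_def)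
    have cV: "card V = Suc (card ?V)" using card.remove[OF fin(1) v(1)] by simp
    obtain N where N: "maximum_matching ?E N"
      using maximum_matching_exists[of ?E] fin by auto
    then have mN: "matching ?E N" "card N = matching_number ?E"
      by (auto simp: maximum_matching_def)
    then have mN': "matching E N" using matching_mono[of ?E N E] by auto
    have "v \<notin> \<Union>N" using mN by (auto simp: matching_def)
    then have "card N \<noteq> matching_number E" using v(2) mN' by (auto simp: maximum_matching_def)
    then have nu: "Suc (matching_number ?E) \<le> matching_number E"
      using card_matching_le[OF fin(2) mN'] mN(2) by simp
    obtain S where S: "S \<subseteq> ?V" and le: "card ?V + card S \<le> 2 * matching_number ?E
        + card {C \<in> (?V - S) // connected_rel (?V - S) {e \<in> ?E. e \<inter> S = {}}. odd (card C)}"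
      using less.hyps[OF _ G'] cV by auto
    have cS: "card (insert v S) = Suc (card S)"
      using S fin by (intro card_insert_disjoint) (auto intro: finite_subset)
    have VS: "?V - S = V - insert v S" by auto
    have ES: "{e \<in> ?E. e \<inter> S = {}} = {e \<in> E. e \<inter> insert v S = {}}" by auto
    show ?thesis
    proof (intro exI conjI)
      show "insert v S \<subseteq> V" using S v(1) by auto
      show "card V + card (insert v S) \<le> 2 * matching_number E
        + card {C \<in> (V - insert v S) // connected_rel (V - insert v S)
            {e \<in> E. e \<inter> insert v S = {}}. odd (card C)}"
        using le nu cV cS unfolding VS ES by linarith
    qed
  next
    case False
    then have inessential: "\<And>v. v \<in> V \<Longrightarrow> \<exists>M. maximum_matching E M \<and> v \<notin> \<Union>M" by blast
    let ?R = "connected_rel V E"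
    \<comment> \<open>The missed vertices are injected into the odd components that contain them.\<close>
    let ?O = "{C \<in> V // ?R. odd (card C)}"
    obtain M where M: "maximum_matching E M" using maximum_matching_exists[OF fin(2)] .
    have only: "x = y" if "(x, y) \<in> ?R" "x \<notin> \<Union>M" "y \<notin> \<Union>M" for x y
    proof (rule gallai_missed_distinct_components[OF G inessential M that(2,3)])
      show "(x, y) \<in> (adj_rel E)\<^sup>*" using that(1) by (simp add: connected_rel_def)
    qed
    have inj: "inj_on (\<lambda>x. ?R `` {x}) (V - \<Union>M)"
    proof (rule inj_onI)
      fix x y assume xy: "x \<in> V - \<Union>M" "y \<in> V - \<Union>M" and eq: "?R `` {x} = ?R `` {y}"
      have "(x, y) \<in> ?R" using xy(2) by (intro eq_equiv_class[OF eq connected_rel_equiv]) simp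
      then show "x = y" by (rule only) (use xy in simp_all)
    qed
    have "(\<lambda>x. ?R `` {x}) ` (V - \<Union>M) \<subseteq> ?O"
    proof clarify
      fix x assume x: "x \<in> V" "x \<notin> \<Union>M"
      have C: "?R `` {x} \<in> V // ?R" using x(1) by (rule quotientI)
      moreover have "odd (card (?R `` {x}))"
      proof (rule odd_component_of_missed_vertex[OF G _ C])
        show "matching E M" using M by (simp add: maximum_matching_def)
        show "x \<in> ?R `` {x}" using x by (simp add: connected_rel_def)
        show "y = x" if "y \<in> ?R `` {x}" "y \<notin> \<Union>M" for y
          using only[of x y] that x(2) by simp
      qed (fact x(2))
      ultimately show "?R `` {x} \<in> V // ?R \<and> odd (card (?R `` {x}))" by blast
    qed
    then have "card (V - \<Union>M) \<le> card ?O"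
      using connected_rel_finite_quotient[OF fin(1)] by (intro card_inj_on_le[OF inj]) simp_all
    then show ?thesis
      using card_missed_vertices[OF G M] by (intro exI[of _ "{}"]) auto
  qed
qed

section \<open>Counting edges around a deleted vertex set\<close>

text \<open>The vertex sets of the components of the graph that remains when the vertices in \<open>S\<close> are deleted.\<close>

definition deleted_components :: "'a set \<Rightarrow> 'a set set \<Rightarrow> 'a set \<Rightarrow> 'a set set" where
  "deleted_components V E S = (V - S) // connected_rel (V - S) {e \<in> E. e \<inter> S = {}}"

text \<open>The edges that meet both \<open>A\<close> and \<open>B\<close>. For disjoint \<open>A\<close> and \<open>B\<close> these are the edges with one
  end in each.\<close>

definition edges_between :: "'a set set \<Rightarrow> 'a set \<Rightarrow> 'a set \<Rightarrow> 'a set set" where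
  "edges_between E A B = {e \<in> E. e \<inter> A \<noteq> {} \<and> e \<inter> B \<noteq> {}}"

text \<open>The edges with both ends in \<open>A\<close>.\<close>

definition edges_inside :: "'a set set \<Rightarrow> 'a set \<Rightarrow> 'a set set" where
  "edges_inside E A = {e \<in> E. e \<subseteq> A}"

lemma simple_graph_delete:
  "simple_graph V E \<Longrightarrow> simple_graph (V - S) {e \<in> E. e \<inter> S = {}}"
  by (auto simp: simple_graph_def)

lemma deleted_components_subset:
  assumes "C \<in> deleted_components V E S"
  shows "C \<subseteq> V - S" "C \<noteq> {}"
  using in_quotient_imp_subset[OF connected_rel_equiv assms[unfolded deleted_components_def]]
    in_quotient_imp_non_empty[OF connected_rel_equiv assms[unfolded deleted_components_def]] .

lemma deleted_components_finite:
  assumes "simple_graph V E"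
  shows "finite (deleted_components V E S)"
  unfolding deleted_components_def
  using simple_graph_finite(1)[OF simple_graph_delete[OF assms]] by (rule connected_rel_finite_quotient)

lemma Union_deleted_components: "\<Union>(deleted_components V E S) = V - S"
  unfolding deleted_components_def by (rule Union_quotient[OF connected_rel_equiv])

lemma deleted_components_disjoint:
  assumes "C \<in> deleted_components V E S" "D \<in> deleted_components V E S" "x \<in> C" "x \<in> D"
  shows "C = D"
  using quotient_disj[OF connected_rel_equiv] assms unfolding deleted_components_def by blast

lemma deleted_component_edge:
  assumes "simple_graph V E" "C \<in> deleted_components V E S" "e \<in> E" "e \<inter> S = {}" "e \<inter> C \<noteq> {}"
  shows "e \<subseteq> C"
  using component_edge_subset[OF simple_graph_delete[OF assms(1)], of C S e] assms(2-)
  unfolding deleted_components_def by blast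

lemma sum_of_bool_card:
  assumes "finite A"
  shows "(\<Sum>x\<in>A. of_bool (P x)) = card {x \<in> A. P x}"
proof -
  have "A \<inter> Collect P = {x \<in> A. P x}" by auto
  then show ?thesis using assms by (simp add: sum_of_bool_eq)
qed

lemma degree_sum:
  assumes "finite E" "finite A"
  shows "(\<Sum>v\<in>A. degree E v) = (\<Sum>e\<in>E. card (e \<inter> A))"
proof -
  have "(\<Sum>v\<in>A. degree E v) = (\<Sum>v\<in>A. \<Sum>e\<in>E. of_bool (v \<in> e))"
    unfolding degree_def sum_of_bool_card[OF assms(1)] ..
  also have "\<dots> = (\<Sum>e\<in>E. \<Sum>v\<in>A. of_bool (v \<in> e))" by (rule sum.swap)
  also have "\<dots> = (\<Sum>e\<in>E. card {v \<in> A. v \<in> e})"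
    unfolding sum_of_bool_card[OF assms(2)] ..
  also have "\<dots> = (\<Sum>e\<in>E. card (e \<inter> A))"
    by (intro sum.cong arg_cong[of _ _ card]) auto
  finally show ?thesis .
qed

lemma degree_sum_component:
  assumes G: "simple_graph V E" and C: "C \<in> deleted_components V E S"
  shows "(\<Sum>v\<in>C. degree E v) = 2 * card (edges_inside E C) + card (edges_between E S C)"
proof -
  have fin: "finite V" "finite E" using simple_graph_finite[OF G] by auto
  have CV: "C \<subseteq> V - S" using deleted_components_subset[OF C] by blast
  then have finC: "finite C" using fin by (auto intro: finite_subset)
  have "card (e \<inter> C) = 2 * of_bool (e \<subseteq> C) + of_bool (e \<inter> S \<noteq> {} \<and> e \<inter> C \<noteq> {})" if e: "e \<in> E" for e
  proof -
    obtain x y where xy: "e = {x, y}" "x \<noteq> y" using simple_graph_edge(4)[OF G e] by blast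
    consider "e \<inter> C = {}" | "e \<subseteq> C" | "e \<inter> C \<noteq> {}" "e \<inter> S \<noteq> {}"
      using deleted_component_edge[OF G C e] by blast
    then show ?thesis
    proof cases
      case 1
      then have "\<not> e \<subseteq> C" using xy by auto
      then show ?thesis using 1 by simp
    next
      case 2
      then have "e \<inter> C = e" "e \<inter> S = {}" using CV by auto
      then show ?thesis using 2 xy by simp
    next
      case 3
      then have "\<not> e \<subseteq> C" using CV by blast
      moreover have "e \<inter> C = {x} \<or> e \<inter> C = {y}" using 3 xy CV by blast
      then have "card (e \<inter> C) = 1" by auto
      ultimately show ?thesis using 3 by simp
    qed
  qed
  then have "(\<Sum>v\<in>C. degree E v)
      = (\<Sum>e\<in>E. 2 * of_bool (e \<subseteq> C) + of_bool (e \<inter> S \<noteq> {} \<and> e \<inter> C \<noteq> {}))"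
    unfolding degree_sum[OF fin(2) finC] by (rule sum.cong[OF refl])
  also have "\<dots> = 2 * (\<Sum>e\<in>E. of_bool (e \<subseteq> C)) + (\<Sum>e\<in>E. of_bool (e \<inter> S \<noteq> {} \<and> e \<inter> C \<noteq> {}))"
    unfolding sum.distrib sum_distrib_left ..
  also have "\<dots> = 2 * card (edges_inside E C) + card (edges_between E S C)"
    unfolding sum_of_bool_card[OF fin(2)] edges_inside_def edges_between_def ..
  finally show ?thesis .
qed

lemma sum_edges_between:
  assumes G: "simple_graph V E"
  shows "(\<Sum>C\<in>deleted_components V E S. card (edges_between E S C))
    = card {e \<in> E. e \<inter> S \<noteq> {} \<and> \<not> e \<subseteq> S}"
proof -
  let ?D = "deleted_components V E S"
  note finE = simple_graph_finite(2)[OF G] and finD = deleted_components_finite[OF G, of S]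
  have *: "card {C \<in> ?D. e \<inter> S \<noteq> {} \<and> e \<inter> C \<noteq> {}} = of_bool (e \<inter> S \<noteq> {} \<and> \<not> e \<subseteq> S)"
    if e: "e \<in> E" for e
  proof (cases "e \<inter> S \<noteq> {} \<and> \<not> e \<subseteq> S")
    case True
    then obtain x y where xy: "e = {x, y}" "x \<in> S" "y \<notin> S" using simple_graph_edge(4)[OF G e] by blast
    then have "y \<in> \<Union>?D" using simple_graph_edge(1)[OF G e] unfolding Union_deleted_components by auto
    then obtain C where C: "C \<in> ?D" "y \<in> C" by blast
    have "{C \<in> ?D. e \<inter> S \<noteq> {} \<and> e \<inter> C \<noteq> {}} = {C}"
    proof (intro subset_antisym subsetI)
      fix B assume B: "B \<in> {C \<in> ?D. e \<inter> S \<noteq> {} \<and> e \<inter> C \<noteq> {}}"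
      then have "y \<in> B" using xy deleted_components_subset(1)[of B V E S] by blast
      then show "B \<in> {C}" using deleted_components_disjoint[of B V E S C y] B C by simp
    qed (use C xy in auto)
    then show ?thesis using True by simp
  next
    case False
    then have "{C \<in> ?D. e \<inter> S \<noteq> {} \<and> e \<inter> C \<noteq> {}} = {}"
      using deleted_components_subset(1)[of _ V E S] by blast
    then have "card {C \<in> ?D. e \<inter> S \<noteq> {} \<and> e \<inter> C \<noteq> {}} = 0" by (simp only: card.empty)
    then show ?thesis using False by (simp only: of_bool_eq)
  qed
  have "(\<Sum>C\<in>?D. card (edges_between E S C)) = (\<Sum>C\<in>?D. \<Sum>e\<in>E. of_bool (e \<inter> S \<noteq> {} \<and> e \<inter> C \<noteq> {}))"
    unfolding sum_of_bool_card[OF finE] edges_between_def ..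
  also have "\<dots> = (\<Sum>e\<in>E. \<Sum>C\<in>?D. of_bool (e \<inter> S \<noteq> {} \<and> e \<inter> C \<noteq> {}))" by (rule sum.swap)
  also have "\<dots> = (\<Sum>e\<in>E. of_bool (e \<inter> S \<noteq> {} \<and> \<not> e \<subseteq> S))"
    unfolding sum_of_bool_card[OF finD] by (rule sum.cong[OF refl *])
  also have "\<dots> = card {e \<in> E. e \<inter> S \<noteq> {} \<and> \<not> e \<subseteq> S}" by (rule sum_of_bool_card[OF finE])
  finally show ?thesis .
qed

lemma degree_sum_deleted_set:
  assumes G: "simple_graph V E" and S: "S \<subseteq> V"
  shows "(\<Sum>v\<in>S. degree E v)
    = 2 * card (edges_inside E S) + (\<Sum>C\<in>deleted_components V E S. card (edges_between E S C))"
proof -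
  have fin: "finite S" "finite E" using simple_graph_finite[OF G] S by (auto intro: finite_subset)
  have "card (e \<inter> S) = 2 * of_bool (e \<subseteq> S) + of_bool (e \<inter> S \<noteq> {} \<and> \<not> e \<subseteq> S)" if e: "e \<in> E" for e
  proof -
    obtain x y where "e = {x, y}" "x \<noteq> y" using simple_graph_edge(4)[OF G e] by blast
    then show ?thesis by (cases "x \<in> S"; cases "y \<in> S") auto
  qed
  then have "(\<Sum>v\<in>S. degree E v)
      = (\<Sum>e\<in>E. 2 * of_bool (e \<subseteq> S) + of_bool (e \<inter> S \<noteq> {} \<and> \<not> e \<subseteq> S))"
    unfolding degree_sum[OF fin(2,1)] by (rule sum.cong[OF refl])
  also have "\<dots> = 2 * (\<Sum>e\<in>E. of_bool (e \<subseteq> S)) + (\<Sum>e\<in>E. of_bool (e \<inter> S \<noteq> {} \<and> \<not> e \<subseteq> S))"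
    unfolding sum.distrib sum_distrib_left ..
  also have "\<dots> = 2 * card (edges_inside E S) + card {e \<in> E. e \<inter> S \<noteq> {} \<and> \<not> e \<subseteq> S}"
    unfolding sum_of_bool_card[OF fin(2)] edges_inside_def ..
  finally show ?thesis unfolding sum_edges_between[OF G] .
qed

text \<open>Contracting each component of the graph without \<open>S\<close> to a point leaves \<open>c\<close> components; so the
  contracted graph has at least as many edges as it has points, less \<open>c\<close>. Equivalently, the graph of the
  edges that avoid \<open>S\<close> has \<open>card S\<close> singleton components besides the given ones, and each further edge
  lowers the number of components by at most one.\<close>

lemma contracted_components_le:
  assumes G: "simple_graph V E" and S: "S \<subseteq> V"
  shows "card S + card (deleted_components V E S)
    \<le> card (edges_inside E S) + (\<Sum>C\<in>deleted_components V E S. card (edges_between E S C))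
      + num_components V E"
proof -
  let ?D = "deleted_components V E S" and ?F = "{e \<in> E. e \<inter> S = {}}"
    and ?I = "edges_inside E S" and ?B = "{e \<in> E. e \<inter> S \<noteq> {} \<and> \<not> e \<subseteq> S}"
  have fin: "finite V" "finite E" "finite S" using simple_graph_finite[OF G] S by (auto intro: finite_subset)
  have D: "?D \<subseteq> V // connected_rel V ?F"
  proof
    fix C assume C: "C \<in> ?D"
    show "C \<in> V // connected_rel V ?F"
    proof (rule component_of_supergraph)
      show "C \<in> (V - S) // connected_rel (V - S) ?F" using C unfolding deleted_components_def .
      show "e \<subseteq> C" if "e \<in> ?F" "e \<inter> C \<noteq> {}" for e
        using deleted_component_edge[OF G C] that by blast
    qed auto
  qed
  have sing: "(\<lambda>x. {x}) ` S \<subseteq> V // connected_rel V ?F"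
  proof clarify
    fix x assume x: "x \<in> S"
    show "{x} \<in> V // connected_rel V ?F"
    proof (rule component_of_supergraph)
      show "{x} \<in> {x} // connected_rel {x} {}"
        by (auto simp: quotient_def connected_rel_def)
    qed (use x S in auto)
  qed
  have "card S + card ?D = card ((\<lambda>x. {x}) ` S \<union> ?D)"
  proof -
    have "(\<lambda>x. {x}) ` S \<inter> ?D = {}" using deleted_components_subset(1)[of _ V E S] by blast
    then show ?thesis
      using fin deleted_components_finite[OF G, of S] by (simp add: card_Un_disjoint card_image)
  qed
  also have "\<dots> \<le> num_components V ?F"
    unfolding num_components_def using D sing fin by (intro card_mono connected_rel_finite_quotient) auto
  also have "\<dots> \<le> num_components V (?F \<union> (?I \<union> ?B)) + card (?I \<union> ?B)"
    using G fin by (intro num_components_add_edges) (auto simp: simple_graph_def edges_inside_def)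
  also have "?F \<union> (?I \<union> ?B) = E" by (auto simp: edges_inside_def)
  also have "card (?I \<union> ?B) \<le> card ?I + card ?B" by (rule card_Un_le)
  finally show ?thesis unfolding sum_edges_between[OF G] by simp
qed

lemma card_isolated_deleted_components_le:
  assumes G: "simple_graph V E"
  shows "card {C \<in> deleted_components V E S. edges_between E S C = {}} \<le> num_components V E"
  unfolding num_components_def
proof (rule card_mono)
  show "finite (V // connected_rel V E)"
    using connected_rel_finite_quotient simple_graph_finite(1)[OF G] by blast
  show "{C \<in> deleted_components V E S. edges_between E S C = {}} \<subseteq> V // connected_rel V E"
  proof clarify
    fix C assume C: "C \<in> deleted_components V E S" and e: "edges_between E S C = {}"
    show "C \<in> V // connected_rel V E"
    proof (rule component_of_supergraph)
      show "C \<in> (V - S) // connected_rel (V - S) {e \<in> E. e \<inter> S = {}}"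
        using C unfolding deleted_components_def .
      show "f \<subseteq> C" if "f \<in> E" "f \<inter> C \<noteq> {}" for f
        using deleted_component_edge[OF G C that(1)] e that unfolding edges_between_def by blast
    qed auto
  qed
qed

section \<open>Discharging\<close>

text \<open>What the discharging argument uses about a component \<open>C\<close> left after deleting \<open>S\<close>: here \<open>g\<close> gives
  the degrees in the whole graph, \<open>m\<close> is the number of edges inside \<open>C\<close>, and \<open>d\<close> the number of edges
  to \<open>S\<close>. The last two conjuncts are the bounds on \<open>m\<close> due to connectedness and to simplicity.\<close>

definition degree_profile :: "'a set \<Rightarrow> ('a \<Rightarrow> nat) \<Rightarrow> nat \<Rightarrow> nat \<Rightarrow> bool" where
  "degree_profile C g m d \<longleftrightarrow> finite C \<and> C \<noteq> {} \<and> (\<forall>v\<in>C. g v \<le> 3) \<and> sum g C = 2 * m + d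
    \<and> card C \<le> m + 1 \<and> 2 * m \<le> card C * (card C - 1)"

lemma edges_inside_upper:
  assumes "simple_graph V E" "finite C"
  shows "2 * card (edges_inside E C) \<le> card C * (card C - 1)"
proof -
  have "edges_inside E C \<subseteq> {e. e \<subseteq> C \<and> card e = 2}"
    using simple_graph_edge(2)[OF assms(1)] by (auto simp: edges_inside_def)
  then have "card (edges_inside E C) \<le> card {e. e \<subseteq> C \<and> card e = 2}"
    using assms(2) by (intro card_mono) auto
  also have "\<dots> = card C choose 2" using assms(2) by (rule n_subsets)
  finally show ?thesis by (simp add: choose_two)
qed

lemma degree_profile_deleted_component:
  assumes G: "simple_graph V E" and "subcubic V E" and C: "C \<in> deleted_components V E S"
  shows "degree_profile C (degree E) (card (edges_inside E C)) (card (edges_between E S C))"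
  unfolding degree_profile_def
proof (intro conjI)
  have CV: "C \<subseteq> V - S" using deleted_components_subset(1)[OF C] .
  then show finC: "finite C" using simple_graph_finite(1)[OF G] by (auto intro: finite_subset)
  show "C \<noteq> {}" using deleted_components_subset(2)[OF C] .
  show "\<forall>v\<in>C. degree E v \<le> 3" using assms(2) CV by (auto simp: subcubic_def)
  show "sum (degree E) C = 2 * card (edges_inside E C) + card (edges_between E S C)"
    using degree_sum_component[OF G C] .
  have eq: "{e \<in> {e \<in> E. e \<inter> S = {}}. e \<subseteq> C} = edges_inside E C"
    using CV by (auto simp: edges_inside_def)
  show "card C \<le> card (edges_inside E C) + 1"
    using component_card_le_edges[OF simple_graph_delete[OF G] C[unfolded deleted_components_def]]
    unfolding eq .
  show "2 * card (edges_inside E C) \<le> card C * (card C - 1)"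
    using edges_inside_upper[OF G finC] .
qed

text \<open>The discharging principle. Let \<open>S\<close> attain the deficiency. The two local hypotheses bound what
  a vertex of \<open>S\<close> and a component contribute to the deficiency minus the total weight. The term
  \<open>\<beta>\<close> moves charge along the edges between \<open>S\<close> and the components. The terms \<open>\<alpha> * (2 - degree)\<close>
  sum up, over the graph in which the components are contracted, to at most \<open>2 * \<alpha> * c\<close>. The term \<open>\<gamma>\<close> is
  spent on components without edges to \<open>S\<close>, of which there are at most \<open>c\<close>.\<close>

theorem deficiency_le_weight:
  fixes w :: "nat \<Rightarrow> real" and \<alpha> \<beta> \<gamma> :: real and V :: "'a set"
  assumes G: "simple_graph V E" and sub: "subcubic V E"
    and nonneg: "0 \<le> \<alpha>" "0 \<le> \<beta>" "0 \<le> \<gamma>"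
    and deleted: "\<And>k. k \<le> 3 \<Longrightarrow> \<beta> * real k \<le> 1 + w k + \<alpha> * (2 - real k)"
    and component: "\<And>(C :: 'a set) g d. \<exists>m. degree_profile C g m d \<Longrightarrow>
      of_bool (odd (card C))
        \<le> (\<Sum>v\<in>C. w (g v)) + \<alpha> * (2 - real d) + \<beta> * real d + \<gamma> * of_bool (d = 0)"
  shows "real (card V) - 2 * real (matching_number E)
    \<le> (\<Sum>v\<in>V. w (degree E v)) + (2 * \<alpha> + \<gamma>) * real (num_components V E)"
proof -
  obtain S where S: "S \<subseteq> V" and le: "card V + card S \<le> 2 * matching_number E
      + card {C \<in> deleted_components V E S. odd (card C)}"
    using tutte_berge[OF G] unfolding deleted_components_def by blast
  let ?D = "deleted_components V E S" and ?w = "\<lambda>v. w (degree E v)"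
    and ?d = "\<lambda>C. card (edges_between E S C)"
  let ?X = "real (\<Sum>C\<in>?D. ?d C)" and ?I = "real (card (edges_inside E S))"
    and ?c = "real (num_components V E)" and ?Z = "real (card {C \<in> ?D. ?d C = 0})"
  have fin: "finite V" "finite E" "finite S" using simple_graph_finite[OF G] S by (auto intro: finite_subset)
  note finD = deleted_components_finite[OF G, of S]
  have "real (card {C \<in> ?D. odd (card C)}) = (\<Sum>C\<in>?D. of_bool (odd (card C)))"
    using finD by (simp add: sum_of_bool_eq Int_def)
  also have "\<dots> \<le> (\<Sum>C\<in>?D. sum ?w C + \<alpha> * (2 - real (?d C)) + \<beta> * real (?d C) + \<gamma> * of_bool (?d C = 0))"
    using component degree_profile_deleted_component[OF G sub] by (intro sum_mono) blast
  also have "\<dots> = (\<Sum>C\<in>?D. sum ?w C) + \<alpha> * (2 * real (card ?D) - ?X) + \<beta> * ?X + \<gamma> * ?Z"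
    using finD by (simp add: sum.distrib sum_subtractf sum_distrib_left[symmetric] sum_of_bool_eq Int_def)
  also have "(\<Sum>C\<in>?D. sum ?w C) = sum ?w (V - S)"
  proof -
    have "sum ?w (\<Union>?D) = (\<Sum>C\<in>?D. sum ?w C)"
    proof (rule sum.Union_disjoint[simplified comp_def])
      show "\<forall>C\<in>?D. finite C"
        using deleted_components_subset(1)[of _ V E S] fin by (auto intro: finite_subset)
      show "\<forall>A\<in>?D. \<forall>B\<in>?D. A \<noteq> B \<longrightarrow> A \<inter> B = {}"
        using deleted_components_disjoint[of _ V E S] by blast
    qed
    then show ?thesis unfolding Union_deleted_components by simp
  qed
  finally have odd: "real (card {C \<in> ?D. odd (card C)})
    \<le> sum ?w (V - S) + \<alpha> * (2 * real (card ?D) - ?X) + \<beta> * ?X + \<gamma> * ?Z" .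
  have degS: "real (\<Sum>v\<in>S. degree E v) = 2 * ?I + ?X"
    unfolding degree_sum_deleted_set[OF G S] by simp
  have "\<beta> * real (\<Sum>v\<in>S. degree E v) = (\<Sum>v\<in>S. \<beta> * real (degree E v))"
    by (simp add: sum_distrib_left)
  also have "\<dots> \<le> (\<Sum>v\<in>S. 1 + ?w v + \<alpha> * (2 - real (degree E v)))"
    using deleted sub S by (intro sum_mono) (auto simp: subcubic_def)
  also have "\<dots> = real (card S) + sum ?w S + \<alpha> * (2 * real (card S) - real (\<Sum>v\<in>S. degree E v))"
    by (simp add: sum.distrib sum_subtractf sum_distrib_left[symmetric])
  finally have S_le: "\<beta> * (2 * ?I + ?X) \<le> real (card S) + sum ?w S + \<alpha> * (2 * real (card S) - (2 * ?I + ?X))"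
    unfolding degS .
  have "real (card S) + real (card ?D) \<le> ?I + ?X + ?c"
    using contracted_components_le[OF G S] by linarith
  then have c: "\<alpha> * (real (card S) + real (card ?D)) \<le> \<alpha> * (?I + ?X + ?c)"
    using nonneg by (intro mult_left_mono)
  have "{C \<in> ?D. ?d C = 0} = {C \<in> ?D. edges_between E S C = {}}"
    using fin by (auto simp: edges_between_def)
  then have "?Z \<le> ?c" using card_isolated_deleted_components_le[OF G, of S] by simp
  then have Z: "\<gamma> * ?Z \<le> \<gamma> * ?c" using nonneg by (intro mult_left_mono)
  have I: "0 \<le> \<beta> * ?I" using nonneg by simp
  have "sum ?w V = sum ?w S + sum ?w (V - S)"
    using sum.subset_diff[OF S fin(1), of ?w] by simp
  moreover have "real (card V) + real (card S)
      \<le> 2 * real (matching_number E) + real (card {C \<in> ?D. odd (card C)})"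
    using le by linarith
  ultimately show ?thesis using odd S_le c Z I by (simp add: algebra_simps)
qed

section \<open>The five weightings\<close>

text \<open>The weight of a vertex of degree \<open>k\<close>. Degree \<open>0\<close> gets weight \<open>1\<close>, so that isolated vertices
  cancel against their share of \<open>card V\<close>.\<close>

definition degree_weight :: "real \<Rightarrow> real \<Rightarrow> real \<Rightarrow> nat \<Rightarrow> real" where
  "degree_weight w\<^sub>1 w\<^sub>2 w\<^sub>3 k = (if k = 1 then w\<^sub>1 else if k = 2 then w\<^sub>2 else if k = 3 then w\<^sub>3 else 1)"

lemma le_three_cases:
  fixes k :: nat
  assumes "k \<le> 3"
  obtains "k = 0" | "k = 1" | "k = 2" | "k = 3"
  using assms by linarith

lemma sum_by_degree:
  fixes f :: "nat \<Rightarrow> real"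
  assumes "finite V" "subcubic V E"
  shows "(\<Sum>v\<in>V. f (degree E v)) = real (num_degree V E 0) * f 0 + real (num_degree V E 1) * f 1
    + real (num_degree V E 2) * f 2 + real (num_degree V E 3) * f 3"
proof -
  have "(\<Sum>v\<in>V. f (degree E v)) = (\<Sum>k\<in>{..3}. \<Sum>v | v \<in> V \<and> degree E v = k. f (degree E v))"
    using assms by (intro sum.group[symmetric]) (auto simp: subcubic_def)
  also have "\<dots> = (\<Sum>k\<in>{..3}. real (num_degree V E k) * f k)"
    by (simp add: num_degree_def)
  also have "{..3::nat} = {0, 1, 2, 3}" by auto
  finally show ?thesis by simp
qed

lemma matching_number_lower_bound:
  fixes V :: "'a set"
  assumes G: "simple_graph V E" and sub: "subcubic V E"
    and nonneg: "0 \<le> \<alpha>" "0 \<le> \<beta>" "0 \<le> \<gamma>"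
    and deleted: "\<And>k. k \<le> 3 \<Longrightarrow> \<beta> * real k \<le> 1 + degree_weight w\<^sub>1 w\<^sub>2 w\<^sub>3 k + \<alpha> * (2 - real k)"
    and component: "\<And>(C :: 'a set) g d. \<exists>m. degree_profile C g m d \<Longrightarrow>
      of_bool (odd (card C)) \<le> (\<Sum>v\<in>C. degree_weight w\<^sub>1 w\<^sub>2 w\<^sub>3 (g v))
        + \<alpha> * (2 - real d) + \<beta> * real d + \<gamma> * of_bool (d = 0)"
  shows "(1 - w\<^sub>1) * real (num_degree V E 1) + (1 - w\<^sub>2) * real (num_degree V E 2)
    + (1 - w\<^sub>3) * real (num_degree V E 3) - (2 * \<alpha> + \<gamma>) * real (num_components V E)
    \<le> 2 * real (matching_number E)"
proof -
  have fin: "finite V" using simple_graph_finite(1)[OF G] .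
  have "real (card V) = (\<Sum>v\<in>V. 1)" by simp
  also have "\<dots> = real (num_degree V E 0) + real (num_degree V E 1)
      + real (num_degree V E 2) + real (num_degree V E 3)"
    using sum_by_degree[OF fin sub, of "\<lambda>_. 1"] by simp
  finally have "real (card V) = \<dots>" .
  then show ?thesis
    using deficiency_le_weight[OF G sub nonneg deleted component]
    unfolding sum_by_degree[OF fin sub] by (simp add: degree_weight_def algebra_simps)
qed

text \<open>A linear lower bound on the weight function turns into a bound by the numbers of vertices and
  edges, because the degrees in \<open>C\<close> sum up to \<open>2 * m + d\<close>.\<close>

lemma linear_weight_bound:
  fixes a b :: real
  assumes "degree_profile C g m d" "\<And>k. k \<le> 3 \<Longrightarrow> a + b * real k \<le> w k"
  shows "a * real (card C) + b * (2 * real m + real d) \<le> (\<Sum>v\<in>C. w (g v))"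
proof -
  have s: "real (sum g C) = 2 * real m + real d" using assms(1) by (simp add: degree_profile_def)
  have "a * real (card C) + b * real (sum g C) = (\<Sum>v\<in>C. a + b * real (g v))"
    by (simp add: sum.distrib sum_distrib_left)
  also have "\<dots> \<le> (\<Sum>v\<in>C. w (g v))"
    using assms by (intro sum_mono) (auto simp: degree_profile_def)
  finally show ?thesis unfolding s .
qed

lemma degree_profile_card_pos: "degree_profile C g m d \<Longrightarrow> 1 \<le> card C"
  by (auto simp: degree_profile_def Suc_le_eq card_gt_0_iff)

text \<open>The estimates behind the component hypothesis of the discharging principle, for the five choices
  of weights. The first three do not need that \<open>C\<close> is odd.\<close>

lemma component_bound_1:
  assumes "degree_profile C g m d"
  shows "1 \<le> (\<Sum>v\<in>C. degree_weight 0 0 1 (g v)) + 1/2 * (2 - real d) + 1/2 * real d"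
proof -
  have "0 * real (card C) + 0 * (2 * real m + real d) \<le> (\<Sum>v\<in>C. degree_weight 0 0 1 (g v))"
    by (rule linear_weight_bound[OF assms]) (simp add: degree_weight_def)
  then show ?thesis by (simp add: field_simps)
qed

lemma component_bound_2:
  assumes "degree_profile C g m d"
  shows "1 \<le> (\<Sum>v\<in>C. degree_weight (-1/3) (1/3) 1 (g v)) + 1 * (2 - real d) + 1/3 * real d"
proof -
  \<comment> \<open>The line \<open>2/3 * k - 1\<close> interpolates the weights of degrees 1, 2 and 3 and lies below that of degree 0.
    As \<open>2 * m + d \<ge> 2 * card C - 2 + d\<close>, it gives at least \<open>(card C - 4 + 2 * d) / 3\<close>.\<close>
  have "(-1) * real (card C) + 2/3 * (2 * real m + real d)
      \<le> (\<Sum>v\<in>C. degree_weight (-1/3) (1/3) 1 (g v))"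
    by (rule linear_weight_bound[OF assms]) (auto simp: degree_weight_def elim!: le_three_cases)
  moreover have "real (card C) \<le> real m + 1" "1 \<le> real (card C)"
    using assms degree_profile_card_pos[OF assms] by (auto simp: degree_profile_def)
  ultimately show ?thesis by (simp add: field_simps)
qed

lemma component_bound_3:
  assumes "degree_profile C g m d"
  shows "1 \<le> (\<Sum>v\<in>C. degree_weight (1/2) 0 (1/2) (g v)) + 1/2 * real d + of_bool (d = 0)"
proof -
  have nonneg: "0 \<le> degree_weight (1/2) 0 (1/2) k" for k by (simp add: degree_weight_def)
  then have *: "0 \<le> (\<Sum>v\<in>C. degree_weight (1/2) 0 (1/2) (g v))" by (simp add: sum_nonneg)
  consider "d = 0" | "d = 1" | "2 \<le> d" by linarith
  then show ?thesis
  proof cases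
    case 2
    \<comment> \<open>With a single edge leaving \<open>C\<close>, the degree sum is odd, so some vertex of \<open>C\<close> has odd degree
      and weight \<open>1/2\<close>.\<close>
    then have "odd (sum g C)" using assms by (simp add: degree_profile_def)
    then obtain v where v: "v \<in> C" "odd (g v)" by (meson dvd_sum)
    then have "g v \<le> 3" using assms by (simp add: degree_profile_def)
    then have "1/2 = degree_weight (1/2) 0 (1/2) (g v)"
      using v(2) by (auto simp: degree_weight_def elim!: le_three_cases)
    also have "\<dots> \<le> (\<Sum>v\<in>C. degree_weight (1/2) 0 (1/2) (g v))"
      using v(1) nonneg assms by (intro member_le_sum) (auto simp: degree_profile_def)
    finally show ?thesis using 2 by simp
  qed (use * in auto)
qed

lemma degree_profile_singleton:
  assumes "degree_profile C g m d" "card C = 1"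
  obtains v where "C = {v}" "g v = d" "d \<le> 3"
proof -
  obtain v where "C = {v}" using assms(2) by (auto simp: card_1_singleton_iff)
  then show ?thesis using assms that by (auto simp: degree_profile_def)
qed

text \<open>In the last two weightings every vertex weighs at least \<open>1/8\<close> or \<open>1/9\<close>, which suffices for
  components with seven or more vertices. The smaller odd ones are examined with these bounds on the
  number of edges.\<close>

lemma degree_profile_odd_cases:
  assumes "degree_profile C g m d" "odd (card C)"
  obtains "card C = 1" "m = 0" | "card C = 3" "m \<le> 3" | "card C = 5" "2 * m + d \<le> 15" | "7 \<le> card C"
proof -
  have "sum g C \<le> card C * 3"
    using sum_bounded_above[of C g 3] assms(1) by (simp add: degree_profile_def)
  then have "2 * m + d \<le> card C * 3" using assms(1) by (simp add: degree_profile_def)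
  moreover have "2 * m \<le> card C * (card C - 1)" using assms(1) by (simp add: degree_profile_def)
  moreover have "card C = 1 \<or> card C = 3 \<or> card C = 5 \<or> 7 \<le> card C" using assms(2) by presburger
  ultimately show ?thesis using that by force
qed

lemma component_bound_4:
  assumes P: "degree_profile C g m d"
  shows "of_bool (odd (card C)) \<le> (\<Sum>v\<in>C. degree_weight (5/8) (1/4) (1/8) (g v)) + 3/8 * real d + 1/4 * of_bool (d = 0)"
proof -
  let ?w = "degree_weight (5/8) (1/4) (1/8)"
  \<comment> \<open>The line \<open>1/2 - k/8\<close> and the constant in \<open>B\<close> are nowhere above the weights.\<close>
  have A: "1/2 * real (card C) + (-1/8) * (2 * real m + real d) \<le> (\<Sum>v\<in>C. ?w (g v))"
    by (rule linear_weight_bound[OF P]) (auto simp: degree_weight_def elim!: le_three_cases)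
  have B: "1/8 * real (card C) + 0 * (2 * real m + real d) \<le> (\<Sum>v\<in>C. ?w (g v))"
    by (rule linear_weight_bound[OF P]) (auto simp: degree_weight_def elim!: le_three_cases)
  show ?thesis
  proof (cases "odd (card C)")
    case False
    moreover have "0 \<le> real d" by simp
    ultimately show ?thesis using B by (simp add: field_simps del: of_nat_0_le_iff)
  next
    case odd: True
    show ?thesis
    proof (cases rule: degree_profile_odd_cases[OF P odd])
      case 1
      then obtain v where "C = {v}" "g v = d" "d \<le> 3" using degree_profile_singleton[OF P] by blast
      then show ?thesis by (auto simp: degree_weight_def elim!: le_three_cases)
    next
      case 2
      then have "real m \<le> 3" by simp
      then show ?thesis using A B 2 by (cases "d = 0") (auto simp: field_simps)
    next
      case 3
      show ?thesis
      proof (cases "d = 0")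
        case True
        \<comment> \<open>Here parity matters: the degree sum \<open>2 * m\<close> is at most 15, hence at most 14.\<close>
        then have "m \<le> 7" using 3(2) by linarith
        then have "real m \<le> 7" by simp
        then show ?thesis using A 3(1) True odd by simp
      next
        case False
        then show ?thesis using B 3 odd by simp
      qed
    next
      case 4
      then have "7 \<le> real (card C)" by simp
      then show ?thesis using B odd by (cases "d = 0") auto
    qed
  qed
qed

lemma component_bound_5:
  assumes P: "degree_profile C g m d"
  shows "of_bool (odd (card C)) \<le> (\<Sum>v\<in>C. degree_weight (5/9) (1/3) (1/9) (g v)) + 1/9 * (2 - real d) + 1/3 * real d"
proof -
  let ?w = "degree_weight (5/9) (1/3) (1/9)"
  \<comment> \<open>The line \<open>7/9 - 2*k/9\<close> and the constant in \<open>B\<close> are nowhere above the weights.\<close>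
  have A: "7/9 * real (card C) + (-2/9) * (2 * real m + real d) \<le> (\<Sum>v\<in>C. ?w (g v))"
    by (rule linear_weight_bound[OF P]) (auto simp: degree_weight_def elim!: le_three_cases)
  have B: "1/9 * real (card C) + 0 * (2 * real m + real d) \<le> (\<Sum>v\<in>C. ?w (g v))"
    by (rule linear_weight_bound[OF P]) (auto simp: degree_weight_def elim!: le_three_cases)
  show ?thesis
  proof (cases "odd (card C)")
    case False
    moreover have "0 \<le> real d" by simp
    ultimately show ?thesis using B by (simp add: field_simps del: of_nat_0_le_iff)
  next
    case odd: True
    show ?thesis
    proof (cases rule: degree_profile_odd_cases[OF P odd])
      case 1
      then show ?thesis using A odd by (simp add: field_simps)
    next
      case 2
      then have "real m \<le> 3" by simp
      then show ?thesis using A 2 odd by (simp add: field_simps)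
    next
      case 3
      show ?thesis
      proof (cases "d = 0")
        case True
        \<comment> \<open>Here parity matters: the degree sum \<open>2 * m\<close> is at most 15, hence at most 14.\<close>
        then have "m \<le> 7" using 3(2) by linarith
        then have "real m \<le> 7" by simp
        then show ?thesis using A 3(1) True odd by simp
      next
        case False
        then show ?thesis using B 3 odd by (simp add: field_simps)
      qed
    next
      case 4
      then have "7 \<le> real (card C)" by simp
      then show ?thesis using B odd by (simp add: field_simps)
    qed
  qed
qed

lemma matching_number_bound_1:
  fixes V :: "'a set"
  assumes "simple_graph V E" "subcubic V E"
  shows "real (num_degree V E 2) / 2 + real (num_degree V E 1) / 2 - real (num_components V E) / 2
    \<le> real (matching_number E)"
proof -
  have deleted: "1/2 * real k \<le> 1 + degree_weight 0 0 1 k + 1/2 * (2 - real k)" if "k \<le> 3" for k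
    using that by (auto simp: degree_weight_def elim!: le_three_cases)
  have component: "of_bool (odd (card C)) \<le> (\<Sum>v\<in>C. degree_weight 0 0 1 (g v))
      + 1/2 * (2 - real d) + 1/2 * real d + 0 * of_bool (d = 0)"
    if "\<exists>m. degree_profile C g m d" for C :: "'a set" and g d
    using that by (auto simp: of_bool_def dest!: component_bound_1)
  show ?thesis
    using matching_number_lower_bound[OF assms _ _ _ deleted component] by (simp add: field_simps)
qed

lemma matching_number_bound_2:
  fixes V :: "'a set"
  assumes "simple_graph V E" "subcubic V E"
  shows "real (num_degree V E 2) / 3 + 2 * real (num_degree V E 1) / 3 - real (num_components V E)
    \<le> real (matching_number E)"
proof -
  have deleted: "1/3 * real k \<le> 1 + degree_weight (-1/3) (1/3) 1 k + 1 * (2 - real k)" if "k \<le> 3" for k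
    using that by (auto simp: degree_weight_def elim!: le_three_cases)
  have component: "of_bool (odd (card C)) \<le> (\<Sum>v\<in>C. degree_weight (-1/3) (1/3) 1 (g v))
      + 1 * (2 - real d) + 1/3 * real d + 0 * of_bool (d = 0)"
    if "\<exists>m. degree_profile C g m d" for C :: "'a set" and g d
    using that by (auto simp: of_bool_def dest!: component_bound_2)
  show ?thesis
    using matching_number_lower_bound[OF assms _ _ _ deleted component] by (simp add: field_simps)
qed

lemma matching_number_bound_3:
  fixes V :: "'a set"
  assumes "simple_graph V E" "subcubic V E"
  shows "real (num_degree V E 3) / 4 + real (num_degree V E 2) / 2 + real (num_degree V E 1) / 4 - real (num_components V E) / 2
    \<le> real (matching_number E)"
proof -
  have deleted: "1/2 * real k \<le> 1 + degree_weight (1/2) 0 (1/2) k + 0 * (2 - real k)" if "k \<le> 3" for k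
    using that by (auto simp: degree_weight_def elim!: le_three_cases)
  have component: "of_bool (odd (card C)) \<le> (\<Sum>v\<in>C. degree_weight (1/2) 0 (1/2) (g v))
      + 0 * (2 - real d) + 1/2 * real d + 1 * of_bool (d = 0)"
    if "\<exists>m. degree_profile C g m d" for C :: "'a set" and g d
    using that by (auto simp: of_bool_def dest!: component_bound_3)
  show ?thesis
    using matching_number_lower_bound[OF assms _ _ _ deleted component] by (simp add: field_simps)
qed

lemma matching_number_bound_4:
  fixes V :: "'a set"
  assumes "simple_graph V E" "subcubic V E"
  shows "7 * real (num_degree V E 3) / 16 + 3 * real (num_degree V E 2) / 8
    + 3 * real (num_degree V E 1) / 16 - real (num_components V E) / 8
    \<le> real (matching_number E)"
proof -
  have deleted: "3/8 * real k \<le> 1 + degree_weight (5/8) (1/4) (1/8) k + 0 * (2 - real k)" if "k \<le> 3" for k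
    using that by (auto simp: degree_weight_def elim!: le_three_cases)
  have component: "of_bool (odd (card C)) \<le> (\<Sum>v\<in>C. degree_weight (5/8) (1/4) (1/8) (g v))
      + 0 * (2 - real d) + 3/8 * real d + 1/4 * of_bool (d = 0)"
    if "\<exists>m. degree_profile C g m d" for C :: "'a set" and g d
    using that by (auto dest!: component_bound_4)
  show ?thesis
    using matching_number_lower_bound[OF assms _ _ _ deleted component] by (simp add: field_simps)
qed

lemma matching_number_bound_5:
  fixes V :: "'a set"
  assumes "simple_graph V E" "subcubic V E"
  shows "4 * real (num_degree V E 3) / 9 + real (num_degree V E 2) / 3
    + 2 * real (num_degree V E 1) / 9 - real (num_components V E) / 9
    \<le> real (matching_number E)"
proof -
  have deleted: "1/3 * real k \<le> 1 + degree_weight (5/9) (1/3) (1/9) k + 1/9 * (2 - real k)" if "k \<le> 3" for k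
    using that by (auto simp: degree_weight_def elim!: le_three_cases)
  have component: "of_bool (odd (card C)) \<le> (\<Sum>v\<in>C. degree_weight (5/9) (1/3) (1/9) (g v))
      + 1/9 * (2 - real d) + 1/3 * real d + 0 * of_bool (d = 0)"
    if "\<exists>m. degree_profile C g m d" for C :: "'a set" and g d
    using that by (auto dest!: component_bound_5)
  show ?thesis
    using matching_number_lower_bound[OF assms _ _ _ deleted component] by (simp add: field_simps)
qed

theorem theorem3:
  fixes V :: "'a set" and E :: "'a set set" and \<nu> c n\<^sub>1 n\<^sub>2 n\<^sub>3 :: real
  assumes "simple_graph V E" and "subcubic V E"
    and "\<nu> = real (matching_number E)"
    and "c = real (num_components V E)"
    and "n\<^sub>1 = real (num_degree V E 1)"
    and "n\<^sub>2 = real (num_degree V E 2)"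
    and "n\<^sub>3 = real (num_degree V E 3)"
  shows "\<nu> \<ge> n\<^sub>2 / 2 + n\<^sub>1 / 2 - c / 2
    \<and> \<nu> \<ge> n\<^sub>2 / 3 + 2 * n\<^sub>1 / 3 - c
    \<and> \<nu> \<ge> n\<^sub>3 / 4 + n\<^sub>2 / 2 + n\<^sub>1 / 4 - c / 2
    \<and> \<nu> \<ge> 7 * n\<^sub>3 / 16 + 3 * n\<^sub>2 / 8 + 3 * n\<^sub>1 / 16 - c / 8
    \<and> \<nu> \<ge> 4 * n\<^sub>3 / 9 + n\<^sub>2 / 3 + 2 * n\<^sub>1 / 9 - c / 9"
  unfolding assms(3-7)
proof (intro conjI)
  show "real (num_degree V E 2) / 2 + real (num_degree V E 1) / 2 - real (num_components V E) / 2
      \<le> real (matching_number E)"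
    using assms(1,2) by (rule matching_number_bound_1)
  show "real (num_degree V E 2) / 3 + 2 * real (num_degree V E 1) / 3 - real (num_components V E)
      \<le> real (matching_number E)"
    using assms(1,2) by (rule matching_number_bound_2)
  show "real (num_degree V E 3) / 4 + real (num_degree V E 2) / 2 + real (num_degree V E 1) / 4 - real (num_components V E) / 2
      \<le> real (matching_number E)"
    using assms(1,2) by (rule matching_number_bound_3)
  show "7 * real (num_degree V E 3) / 16 + 3 * real (num_degree V E 2) / 8
      + 3 * real (num_degree V E 1) / 16 - real (num_components V E) / 8
      \<le> real (matching_number E)"
    using assms(1,2) by (rule matching_number_bound_4)
  show "4 * real (num_degree V E 3) / 9 + real (num_degree V E 2) / 3
      + 2 * real (num_degree V E 1) / 9 - real (num_components V E) / 9
      \<le> real (matching_number E)"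
    using assms(1,2) by (rule matching_number_bound_5)
qed

end
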